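(* Assume the weak approximation property holds with constant $\eta_w>0$: for every $\mathbf v\in\mathbb R^n$ there is $\mathbf v_c\in\mathbb R^{n_c}$ with $\|\mathbf v-P\mathbf v_c\|_D\le\eta_w\|\mathbf v\|_A$. For $\mathbf f\in\mathbb R^n$ let $\mathbf u$ be the solution of $A\mathbf u=\mathbf f$, and let $\mathbf e=\mathbf u-(I-\pi_f)\pi_D\mathbf u$, which is the error $\mathbf u-(I-\pi_f)P\mathbf u_c$ between $\mathbf u$ and the upscaled solution, where $\mathbf u_c\in\mathbb R^{n_c}$ solves $P^T(I-\pi_f)^TA(I-\pi_f)P\,\mathbf u_c=P^T(I-\pi_f)^T\mathbf f$. Then $$\|\mathbf e\|_D\le\eta_w\|\mathbf e\|_A\le\eta_w^2\,\|D^{-\frac12}A\mathbf u\|.$$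
   Context: $A\in\mathbb R^{n\times n}$ is symmetric positive definite (SPD), and $D\in\mathbb R^{n\times n}$ is a diagonal SPD matrix with $\mathbf v^TA\mathbf v\le\mathbf v^TD\mathbf v$ for all $\mathbf v\in\mathbb R^n$. For an SPD matrix $B$, $\|\mathbf v\|_B=\sqrt{\mathbf v^TB\mathbf v}$; $\|\cdot\|$ is the Euclidean norm. The index set $\{1,\dots,n\}$ is partitioned into nonoverlapping aggregates $\mathcal A_1,\dots,\mathcal A_{n_a}$. The prolongation $P\in\mathbb R^{n\times n_c}$, of full column rank with $1\le n_c<n$, is block diagonal with respect to this partition, with blocks $P_{\mathcal A_i}$ (rows indexed by $\mathcal A_i$). On each aggregate, let $D_{\mathcal A_i}=D|_{\mathcal A_i}$ and choose vectors that are orthonormal with respect to $D_{\mathcal A_i}$ and span the $D_{\mathcal A_i}$-orthogonal complement of $\operatorname{Range}(P_{\mathcal A_i})$. Extended by zero outside $\mathcal A_i$, these vectors (for all $i$) are the columns of $P_\perp\in\mathbb R^{n\times(n-n_c)}$. Thus $P_\perp^TDP=0$ and $P_\perp^TDP_\perp=I$. Define $\pi_D=P(P^TDP)^{-1}P^TD$, $A_f=P_\perp^TAP_\perp$ and $\pi_f=P_\perp A_f^{-1}P_\perp^TA$. *)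

theory Defs
  imports "HOL-Analysis.Analysis" "HOL-Library.Disjoint_Sets"
begin

definition spd :: "real^'n^'n \<Rightarrow> bool" where
  "spd B \<longleftrightarrow> transpose B = B \<and> (\<forall>v. v \<noteq> 0 \<longrightarrow> v \<bullet> (B *v v) > 0)"

definition diagonal :: "real^'n^'n \<Rightarrow> bool" where
  "diagonal D \<longleftrightarrow> (\<forall>i j. i \<noteq> j \<longrightarrow> D $ i $ j = 0)"

definition norm_wrt :: "real^'n^'n \<Rightarrow> real^'n \<Rightarrow> real" where
  "norm_wrt B v = sqrt (v \<bullet> (B *v v))"

(* The power -1/2 of a diagonal SPD matrix; meaningful only for such matrices. *)
definition diag_inv_sqrt :: "real^'n^'n \<Rightarrow> real^'n^'n" where
  "diag_inv_sqrt D = (\<chi> i j. if i = j then 1 / sqrt (D $ i $ i) else 0)"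

lemma diag_inv_sqrt_squared:
  assumes "spd D" "diagonal D"
  shows "diag_inv_sqrt D ** diag_inv_sqrt D ** D = mat 1"
proof -
  have pos: "D $ i $ i > 0" for i
  proof -
    have "axis i 1 \<bullet> (D *v axis i 1) > 0"
      using assms(1) by (simp add: spd_def axis_eq_0_iff)
    then show ?thesis
      by (simp add: matrix_vector_mult_basis inner_axis' column_def)
  qed
  have off: "D $ i $ j = 0" if "i \<noteq> j" for i j
    using assms(2) that by (simp add: diagonal_def)
  have sq: "diag_inv_sqrt D ** diag_inv_sqrt D = (\<chi> i j. if i = j then 1 / D $ i $ i else 0)"
    using pos by (simp add: diag_inv_sqrt_def matrix_matrix_mult_def vec_eq_iff
        if_distrib [where f = "\<lambda>x. x * _"] if_distrib [where f = "\<lambda>x. _ * x"]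
        less_imp_le cong: if_cong)
  have "(if i = j then 1 else 0) = (1 / D $ i $ i) * D $ i $ j" for i j
    using pos [of i] off by auto
  then show ?thesis
    unfolding sq
    by (simp add: matrix_matrix_mult_def vec_eq_iff mat_def
        if_distrib [where f = "\<lambda>x. x * _"] cong: if_cong)
qed

(* An aggregate is a set a of row indices. A vector on a is represented by its extension by zero,
   and a block with rows S and columns T by the full-size matrix that vanishes outside S x T. *)
definition block :: "'m set \<Rightarrow> 'n set \<Rightarrow> real^'n^'m \<Rightarrow> real^'n^'m" where
  "block S T M = (\<chi> i j. if i \<in> S \<and> j \<in> T then M $ i $ j else 0)"

(* The function c assigns to each column the aggregate of the block it belongs to. *)
definition block_diagonal :: "'n set set \<Rightarrow> ('k \<Rightarrow> 'n set) \<Rightarrow> real^'k^'n \<Rightarrow> bool" where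
  "block_diagonal \<A> c M \<longleftrightarrow> (\<forall>j. c j \<in> \<A>) \<and> (\<forall>i j. i \<notin> c j \<longrightarrow> M $ i $ j = 0)"

definition local_range :: "('k \<Rightarrow> 'n set) \<Rightarrow> real^'k^'n \<Rightarrow> 'n set \<Rightarrow> (real^'n) set" where
  "local_range c P a = range (\<lambda>x. block a {j. c j = a} P *v x)"

definition local_orth_compl ::
    "real^'n^'n \<Rightarrow> ('k \<Rightarrow> 'n set) \<Rightarrow> real^'k^'n \<Rightarrow> 'n set \<Rightarrow> (real^'n) set" where
  "local_orth_compl D c P a =
     {v. (\<forall>i. i \<notin> a \<longrightarrow> v $ i = 0) \<and> (\<forall>w \<in> local_range c P a. v \<bullet> (block a a D *v w) = 0)}"

(* Q is an admissible P_perp; c and d assign aggregates to the columns of P and Q. *)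
definition is_P_perp ::
    "'n set set \<Rightarrow> real^'n^'n \<Rightarrow> ('k \<Rightarrow> 'n set) \<Rightarrow> real^'k^'n \<Rightarrow> ('l \<Rightarrow> 'n set) \<Rightarrow> real^'l^'n \<Rightarrow> bool" where
  "is_P_perp \<A> D c P d Q \<longleftrightarrow>
     block_diagonal \<A> d Q \<and>
     (\<forall>a \<in> \<A>.
        (\<forall>j k. d j = a \<longrightarrow> d k = a \<longrightarrow>
           column j Q \<bullet> (block a a D *v column k Q) = (if j = k then 1 else 0)) \<and>
        span {column j Q | j. d j = a} = local_orth_compl D c P a)"

definition pi_D :: "real^'n^'n \<Rightarrow> real^'k^'n \<Rightarrow> real^'n^'n" where
  "pi_D D P = P ** matrix_inv (transpose P ** D ** P) ** transpose P ** D"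

definition A_f :: "real^'n^'n \<Rightarrow> real^'l^'n \<Rightarrow> real^'l^'l" where
  "A_f A Q = transpose Q ** A ** Q"

definition pi_f :: "real^'n^'n \<Rightarrow> real^'l^'n \<Rightarrow> real^'n^'n" where
  "pi_f A Q = Q ** matrix_inv (A_f A Q) ** transpose Q ** A"

definition weak_approximation ::
    "real^'n^'n \<Rightarrow> real^'n^'n \<Rightarrow> real^'k^'n \<Rightarrow> real \<Rightarrow> bool" where
  "weak_approximation A D P \<eta> \<longleftrightarrow>
     (\<forall>v. \<exists>v\<^sub>c. norm_wrt D (v - P *v v\<^sub>c) \<le> \<eta> * norm_wrt A v)"

definition coarse_solution ::
    "real^'n^'n \<Rightarrow> real^'k^'n \<Rightarrow> real^'l^'n \<Rightarrow> real^'n \<Rightarrow> real^'k \<Rightarrow> bool" where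
  "coarse_solution A P Q f u\<^sub>c \<longleftrightarrow>
     (transpose P ** transpose (mat 1 - pi_f A Q) ** A ** (mat 1 - pi_f A Q) ** P) *v u\<^sub>c
     = (transpose P ** transpose (mat 1 - pi_f A Q)) *v f"

end

theory Submission
  imports Defs
begin

text \<open>
  Write \<open>Q\<close> for \<open>P_perp\<close>. Both \<open>pi_D\<close> and \<open>pi_f\<close> are instances of one construction: for an SPD
  matrix \<open>B\<close> and an injective matrix \<open>M\<close>, \<open>M (M\<^sup>T B M)\<^sup>-\<^sup>1 M\<^sup>T B\<close> is the \<open>B\<close>-orthogonal projection
  onto the range of \<open>M\<close>. So \<open>pi_D\<close> is the \<open>D\<close>-orthogonal projection onto the range of \<open>P\<close> and
  \<open>pi_f\<close> the \<open>A\<close>-orthogonal projection onto the range of \<open>Q\<close>.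

  Because \<open>D\<close> is diagonal, vectors supported on different aggregates are \<open>D\<close>-orthogonal, hence the
  local conditions on \<open>Q\<close> give the global ones: the columns of \<open>Q\<close> are \<open>D\<close>-orthonormal and
  \<open>D\<close>-orthogonal to the range of \<open>P\<close>. A dimension count then shows that the range of \<open>Q\<close> is the
  whole \<open>D\<close>-orthogonal complement of the range of \<open>P\<close>.

  The observation that carries the proof is that \<open>e = pi_f u\<close>. Indeed \<open>u - pi_D u\<close> lies in this
  complement, that is in the range of \<open>Q\<close>, so \<open>pi_f\<close> fixes it, and
  \<open>e = (u - pi_D u) + pi_f (pi_D u) = pi_f (u - pi_D u) + pi_f (pi_D u) = pi_f u\<close>.
  Everything else follows from this.

  \<^item> As \<open>e\<close> is \<open>D\<close>-orthogonal to the range of \<open>P\<close>, the zero vector is its best approximation there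
    in the \<open>D\<close>-norm, and weak approximation applied to \<open>e\<close> gives
    \<open>\<parallel>e\<parallel>\<^sub>D \<le> \<eta> \<parallel>e\<parallel>\<^sub>A\<close> (lemma \<open>weak_approximation_complement\<close>).

  \<^item> As \<open>u - e\<close> is \<open>A\<close>-orthogonal to the range of \<open>Q\<close>, which contains \<open>e\<close>,
    \<open>\<parallel>e\<parallel>\<^sub>A\<^sup>2 = e \<bullet> A u\<close>. By the weighted Cauchy-Schwarz inequality
    (lemma \<open>inner_le_norm_wrt_dual\<close>) this is at most \<open>\<parallel>e\<parallel>\<^sub>D \<parallel>D\<^sup>-\<^sup>1\<^sup>/\<^sup>2 A u\<parallel>\<close>, hence at most
    \<open>\<eta> \<parallel>e\<parallel>\<^sub>A \<parallel>D\<^sup>-\<^sup>1\<^sup>/\<^sup>2 A u\<parallel>\<close>; divide by \<open>\<parallel>e\<parallel>\<^sub>A\<close>.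

  \<^item> The coarse equation says that \<open>u - (1 - pi_f) P u\<^sub>c\<close> is \<open>A\<close>-orthogonal to the range of
    \<open>(1 - pi_f) P\<close>. The coefficients of \<open>pi_D u\<close> solve it, since there this vector is \<open>e\<close>, which
    lies in the range of \<open>Q\<close>, while the range of \<open>1 - pi_f\<close> is \<open>A\<close>-orthogonal to that of \<open>Q\<close>. The
    solution is unique because \<open>P\<close> is injective and the ranges of \<open>P\<close> and \<open>Q\<close> meet only in
    zero.
\<close>

section \<open>Inner products given by SPD matrices\<close>

lemma inner_transpose_mult: "(transpose M *v x) \<bullet> y = x \<bullet> (M *v y)" for M :: "real^'m^'n"
  by (simp add: dot_lmul_matrix)

lemma spd_inner_commute:
  assumes "spd B"
  shows "v \<bullet> (B *v w) = w \<bullet> (B *v v)"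
  by (metis assms inner_commute inner_transpose_mult spd_def)

lemma spd_inner_nonneg:
  assumes "spd B"
  shows "v \<bullet> (B *v v) \<ge> 0"
  using assms by (cases "v = 0") (auto simp: spd_def less_imp_le)

lemma spd_inner_eq_0:
  assumes "spd B" and "v \<bullet> (B *v v) = 0"
  shows "v = 0"
  using assms by (force simp: spd_def)

lemma spd_mult_eq_0:
  assumes "spd B" and "B *v v = 0"
  shows "v = 0"
  using assms by (intro spd_inner_eq_0) auto

lemma spd_invertible:
  assumes "spd B"
  shows "invertible B"
  using spd_mult_eq_0 [OF assms] by (auto simp: invertible_left_inverse matrix_left_invertible_ker)

lemma matrix_inv_of_invertible:
  assumes "invertible B"
  shows "B ** matrix_inv B = mat 1" and "matrix_inv B ** B = mat 1"
proof -
  have "B ** matrix_inv B = mat 1 \<and> matrix_inv B ** B = mat 1"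
    using assms unfolding invertible_def matrix_inv_def by (rule someI_ex)
  then show "B ** matrix_inv B = mat 1" and "matrix_inv B ** B = mat 1"
    by auto
qed

lemma norm_wrt_nonneg: "spd B \<Longrightarrow> norm_wrt B v \<ge> 0"
  by (simp add: norm_wrt_def spd_inner_nonneg)

lemma norm_wrt_squared: "spd B \<Longrightarrow> (norm_wrt B v)\<^sup>2 = v \<bullet> (B *v v)"
  by (simp add: norm_wrt_def spd_inner_nonneg)

lemma spd_congruence:
  fixes B :: "real^'n^'n" and M :: "real^'m^'n"
  assumes "spd B" and "inj ((*v) M)"
  shows "spd (transpose M ** B ** M)"
  unfolding spd_def
proof (intro conjI allI impI)
  show "transpose (transpose M ** B ** M) = transpose M ** B ** M"
    using assms(1) by (simp add: spd_def matrix_transpose_mul matrix_mul_assoc)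
  fix v :: "real^'m"
  assume "v \<noteq> 0"
  then have "M *v v \<noteq> 0"
    using assms(2) by (metis injD matrix_vector_mult_0_right)
  then have "(M *v v) \<bullet> (B *v (M *v v)) > 0"
    using assms(1) by (simp add: spd_def)
  then show "v \<bullet> ((transpose M ** B ** M) *v v) > 0"
    by (metis inner_commute inner_transpose_mult matrix_vector_mul_assoc)
qed

section \<open>Orthogonal projections\<close>

lemma pi_f_eq_pi_D: "pi_f A Q = pi_D A Q"
  by (simp add: pi_f_def pi_D_def A_f_def)

lemma pi_D_in_range: "\<exists>y. pi_D B M *v x = M *v y"
  unfolding pi_D_def by (metis matrix_vector_mul_assoc)

lemma pi_D_residual_orthogonal:
  fixes B :: "real^'n^'n" and M :: "real^'m^'n"
  assumes "spd B" and "inj ((*v) M)"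
  shows "(M *v z) \<bullet> (B *v (x - pi_D B M *v x)) = 0"
proof -
  define G where "G = transpose M ** B ** M"
  have "invertible G"
    unfolding G_def by (intro spd_invertible spd_congruence assms)
  then have inv: "G ** matrix_inv G = mat 1"
    by (rule matrix_inv_of_invertible(1))
  have "transpose M *v (B *v (pi_D B M *v x)) = (G ** matrix_inv G) *v (transpose M *v (B *v x))"
    by (simp add: pi_D_def G_def matrix_vector_mul_assoc matrix_mul_assoc)
  then have "transpose M *v (B *v (x - pi_D B M *v x)) = 0"
    by (simp add: inv matrix_vector_mult_diff_distrib)
  then show ?thesis
    by (metis inner_commute inner_transpose_mult inner_zero_left)
qed

lemma pi_D_fixes_range:
  fixes B :: "real^'n^'n" and M :: "real^'m^'n"
  assumes "spd B" and "inj ((*v) M)"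
  shows "pi_D B M *v (M *v y) = M *v y"
proof -
  define G where "G = transpose M ** B ** M"
  have "invertible G"
    unfolding G_def by (intro spd_invertible spd_congruence assms)
  then have inv: "matrix_inv G ** G = mat 1"
    by (rule matrix_inv_of_invertible(2))
  have "pi_D B M *v (M *v y) = M *v ((matrix_inv G ** G) *v y)"
    by (simp add: pi_D_def G_def matrix_vector_mul_assoc matrix_mul_assoc)
  then show ?thesis
    by (simp add: inv)
qed

text \<open>
  The range of \<open>Q\<close> is contained in the complement of the range of \<open>P\<close>, and the two have the same
  dimension \<open>CARD('l)\<close>, so they are equal.
\<close>
lemma orthogonal_complement_in_range:
  fixes B :: "real^'n^'n" and P :: "real^'k^'n" and Q :: "real^'l^'n"
  assumes B: "spd B" and P: "inj ((*v) P)" and Q: "inj ((*v) Q)"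
    and orth: "\<And>y z. (Q *v y) \<bullet> (B *v (P *v z)) = 0"
    and card: "CARD('k) + CARD('l) = CARD('n)"
    and w: "\<And>z. w \<bullet> (B *v (P *v z)) = 0"
  shows "\<exists>y. w = Q *v y"
proof -
  define S where "S = range (\<lambda>z. B *v (P *v z))"
  define C where "C = {x \<in> UNIV. \<forall>s \<in> S. orthogonal s x}"
  have S_image: "S = range ((*v) (B ** P))"
    by (simp add: S_def matrix_vector_mul_assoc)
  have "inj ((*v) (B ** P))"
    using P spd_mult_eq_0 [OF B]
    by (simp add: inj_matrix_vector_mult matrix_left_invertible_injective [symmetric]
        matrix_left_invertible_ker matrix_vector_mul_assoc [symmetric])
  then have "dim S = CARD('k)"
    unfolding S_image by (metis full_rank_injective rank_dim_range)
  moreover have "subspace S"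
    unfolding S_image by (intro linear_subspace_image) auto
  moreover have "subspace C"
    unfolding C_def by (auto simp: subspace_def orthogonal_clauses)
  moreover have "dim C + dim S = CARD('n)"
    using dim_subspace_orthogonal_to_vectors [OF \<open>subspace S\<close> subspace_UNIV]
    by (simp add: C_def)
  ultimately have dim_C: "dim C = CARD('l)"
    using card by simp
  have "range ((*v) Q) \<subseteq> C"
    using orth by (auto simp: C_def S_def orthogonal_def inner_commute)
  moreover have "dim (range ((*v) Q)) = CARD('l)"
    using Q by (metis full_rank_injective rank_dim_range)
  moreover have "subspace (range ((*v) Q))"
    by (intro linear_subspace_image) auto
  ultimately have "range ((*v) Q) = C"
    using dim_C \<open>subspace C\<close> by (intro subspace_dim_equal) auto
  moreover have "w \<in> C"
    using w by (auto simp: C_def S_def orthogonal_def inner_commute)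
  ultimately show ?thesis
    by blast
qed

section \<open>Diagonal weights\<close>

lemma diagonal_mult_component:
  assumes "diagonal D"
  shows "(D *v w) $ i = D $ i $ i * w $ i"
proof -
  have "D $ i $ j * w $ j = (if j = i then D $ i $ i * w $ i else 0)" for j
    using assms by (auto simp: diagonal_def)
  then have "(D *v w) $ i = (\<Sum>j\<in>UNIV. if j = i then D $ i $ i * w $ i else 0)"
    unfolding matrix_vector_mult_def vec_lambda_beta by (intro sum.cong refl)
  then show ?thesis by simp
qed

lemma diagonal_inner:
  assumes "diagonal D"
  shows "v \<bullet> (D *v w) = (\<Sum>i\<in>UNIV. v $ i * (D $ i $ i * w $ i))"
  by (simp add: inner_vec_def diagonal_mult_component [OF assms])

lemma diagonal_block:
  "diagonal D \<Longrightarrow> diagonal (block a a D)"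
  by (simp add: diagonal_def block_def)

lemma spd_diagonal_entry_pos:
  assumes "spd D"
  shows "D $ i $ i > 0"
proof -
  have "axis i 1 \<bullet> (D *v axis i 1) > 0"
    using assms by (simp add: spd_def axis_eq_0_iff)
  then show ?thesis
    by (simp add: matrix_vector_mult_basis inner_axis' column_def)
qed

text \<open>
  Cauchy-Schwarz for the factorisation \<open>v \<bullet> w = (D\<^sup>1\<^sup>/\<^sup>2 v) \<bullet> (D\<^sup>-\<^sup>1\<^sup>/\<^sup>2 w)\<close>.
\<close>
lemma inner_le_norm_wrt_dual:
  fixes D :: "real^'n^'n"
  assumes "spd D" and "diagonal D"
  shows "v \<bullet> w \<le> norm_wrt D v * norm (diag_inv_sqrt D *v w)"
proof -
  define x :: "real^'n" where "x = (\<chi> i. sqrt (D $ i $ i) * v $ i)"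
  have pos: "D $ i $ i > 0" for i
    by (rule spd_diagonal_entry_pos [OF assms(1)])
  have "diagonal (diag_inv_sqrt D)"
    by (simp add: diagonal_def diag_inv_sqrt_def)
  then have "(diag_inv_sqrt D *v w) $ i = w $ i / sqrt (D $ i $ i)" for i
    by (simp add: diagonal_mult_component) (simp add: diag_inv_sqrt_def)
  then have "v \<bullet> w = x \<bullet> (diag_inv_sqrt D *v w)"
    using pos by (auto simp: inner_vec_def x_def less_imp_neq [symmetric] intro!: sum.cong)
  also have "\<dots> \<le> norm x * norm (diag_inv_sqrt D *v w)"
    by (rule norm_cauchy_schwarz)
  also have "x \<bullet> x = v \<bullet> (D *v v)"
    unfolding diagonal_inner [OF assms(2)]
    using pos by (auto simp: inner_vec_def x_def less_imp_le intro!: sum.cong)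
  then have "norm x = norm_wrt D v"
    by (simp add: norm_wrt_def norm_eq_sqrt_inner)
  finally show ?thesis .
qed

section \<open>From aggregates to global orthogonality\<close>

lemma block_inner_supported:
  assumes "diagonal D" and "\<And>i. i \<notin> a \<Longrightarrow> v $ i = 0"
  shows "v \<bullet> (block a a D *v w) = v \<bullet> (D *v w)"
  unfolding diagonal_inner [OF assms(1)] diagonal_inner [OF diagonal_block [OF assms(1)]]
  using assms(2) by (auto simp: block_def intro!: sum.cong)

text \<open>A diagonal weight does not couple vectors with disjoint supports.\<close>
lemma diagonal_inner_disjoint:
  assumes "diagonal D" and "a \<inter> b = {}"
    and "\<And>i. i \<notin> a \<Longrightarrow> v $ i = 0" and "\<And>i. i \<notin> b \<Longrightarrow> w $ i = 0"
  shows "v \<bullet> (D *v w) = 0"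
  unfolding diagonal_inner [OF assms(1)]
proof (intro sum.neutral ballI)
  fix i
  show "v $ i * (D $ i $ i * w $ i) = 0"
    using assms(2-4) by (cases "i \<in> a") auto
qed

lemma P_perp_column_orthonormal:
  assumes D: "diagonal D" and part: "partition_on UNIV \<A>" and perp: "is_P_perp \<A> D c P d Q"
  shows "column j Q \<bullet> (D *v column k Q) = (if j = k then 1 else 0)"
proof (cases "d j = d k")
  case True
  have "column j Q \<bullet> (block (d j) (d j) D *v column k Q) = (if j = k then 1 else 0)"
    using perp True by (auto simp: is_P_perp_def block_diagonal_def)
  moreover have "column j Q $ i = 0" if "i \<notin> d j" for i
    using perp that by (auto simp: is_P_perp_def block_diagonal_def column_def)
  ultimately show ?thesis
    by (simp add: block_inner_supported [OF D])
next
  case False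
  have "d j \<inter> d k = {}"
    using part perp False
    by (meson block_diagonal_def disjointD is_P_perp_def partition_onD2)
  then have "column j Q \<bullet> (D *v column k Q) = 0"
    using perp
    by (intro diagonal_inner_disjoint [OF D])
      (auto simp: is_P_perp_def block_diagonal_def column_def)
  then show ?thesis
    using False by auto
qed

text \<open>
  Columns of different aggregates are not coupled by \<open>D\<close>. For columns of the same aggregate the
  definition of the local complement applies, since a column of \<open>P\<close> is the image of a unit vector
  under its block.
\<close>
lemma P_perp_column_orthogonal:
  assumes D: "diagonal D" and part: "partition_on UNIV \<A>" and P: "block_diagonal \<A> c P"
    and perp: "is_P_perp \<A> D c P d Q"
  shows "column j Q \<bullet> (D *v column k P) = 0"
proof -
  have supp: "column j Q $ i = 0" if "i \<notin> d j" for i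
    using perp that by (auto simp: is_P_perp_def block_diagonal_def column_def)
  show ?thesis
  proof (cases "d j = c k")
    case True
    have "block (d j) {l. c l = d j} P *v axis k 1 = column k P"
      using P True
      by (auto simp: matrix_vector_mult_basis column_def block_def block_diagonal_def vec_eq_iff)
    then have "column k P \<in> local_range c P (d j)"
      unfolding local_range_def by (metis rangeI)
    moreover have "column j Q \<in> local_orth_compl D c P (d j)"
    proof -
      have "column j Q \<in> span {column l Q | l. d l = d j}"
        by (intro span_base) auto
      then show ?thesis
        using perp by (auto simp: is_P_perp_def block_diagonal_def)
    qed
    ultimately have "column j Q \<bullet> (block (d j) (d j) D *v column k P) = 0"
      by (auto simp: local_orth_compl_def)
    then show ?thesis
      by (simp add: block_inner_supported [OF D supp])
  next
    case False
    have "d j \<inter> c k = {}"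
      using part perp P False
      by (meson block_diagonal_def disjointD is_P_perp_def partition_onD2)
    then show ?thesis
      using supp P
      by (intro diagonal_inner_disjoint [OF D]) (auto simp: block_diagonal_def column_def)
  qed
qed

lemma inner_mult_columns:
  fixes M :: "real^'m^'n" and B :: "real^'n^'n" and N :: "real^'k^'n"
  shows "(M *v y) \<bullet> (B *v (N *v z)) =
    (\<Sum>j\<in>UNIV. \<Sum>k\<in>UNIV. y $ j * z $ k * (column j M \<bullet> (B *v column k N)))"
proof -
  have "B *v (N *v z) = (\<Sum>k\<in>UNIV. z $ k *\<^sub>R (B *v column k N))"
    by (simp add: matrix_mult_sum [of N] scalar_mult_eq_scaleR
        linear_sum [OF matrix_vector_mul_linear] linear_cmul [OF matrix_vector_mul_linear])
  then show ?thesis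
    by (simp add: matrix_mult_sum [of M] scalar_mult_eq_scaleR inner_sum_left inner_sum_right
        sum_distrib_left mult.assoc mult.left_commute)
      (rule sum.swap)
qed

lemma range_P_perp_orthogonal:
  assumes "diagonal D" and "partition_on UNIV \<A>" and "block_diagonal \<A> c P"
    and "is_P_perp \<A> D c P d Q"
  shows "(Q *v y) \<bullet> (D *v (P *v z)) = 0"
  unfolding inner_mult_columns by (simp add: P_perp_column_orthogonal [OF assms])

lemma P_perp_isometry:
  assumes "diagonal D" and "partition_on UNIV \<A>" and "is_P_perp \<A> D c P d Q"
  shows "(Q *v y) \<bullet> (D *v (Q *v z)) = y \<bullet> z"
  unfolding inner_mult_columns
  by (simp add: P_perp_column_orthonormal [OF assms] inner_vec_def [of y z]
      if_distrib [where f = "\<lambda>x. _ * x"] cong: if_cong)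

lemma inj_P_perp:
  assumes "diagonal D" and "partition_on UNIV \<A>" and "is_P_perp \<A> D c P d Q"
  shows "inj ((*v) Q)"
  using P_perp_isometry [OF assms]
  by (metis (no_types, lifting) injI vector_eq_ldot)

section \<open>The error estimate\<close>

text \<open>
  By Pythagoras, a vector that is \<open>D\<close>-orthogonal to the range of \<open>P\<close> has no better approximation
  there than zero, so weak approximation bounds its own \<open>D\<close>-norm.
\<close>
lemma weak_approximation_complement:
  assumes "spd D" and "weak_approximation A D P \<eta>"
    and "\<And>z. v \<bullet> (D *v (P *v z)) = 0"
  shows "norm_wrt D v \<le> \<eta> * norm_wrt A v"
proof -
  obtain z where z: "norm_wrt D (v - P *v z) \<le> \<eta> * norm_wrt A v"
    using assms(2) by (auto simp: weak_approximation_def)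
  have "(v - P *v z) \<bullet> (D *v (v - P *v z)) = v \<bullet> (D *v v) + (P *v z) \<bullet> (D *v (P *v z))"
    using assms(3) spd_inner_commute [OF assms(1), of v "P *v z"]
    by (simp add: matrix_vector_mult_diff_distrib inner_diff)
  then have "norm_wrt D v \<le> norm_wrt D (v - P *v z)"
    using spd_inner_nonneg [OF assms(1), of "P *v z"] by (simp add: norm_wrt_def)
  with z show ?thesis by simp
qed

text \<open>
  The coarse equation in weak (Galerkin) form: the error is \<open>A\<close>-orthogonal to the range of
  \<open>(1 - pi_f) P\<close>.
\<close>
lemma coarse_solution_iff_orthogonal:
  fixes A :: "real^'n^'n" and P :: "real^'k^'n" and Q :: "real^'l^'n"
  defines "E \<equiv> mat 1 - pi_f A Q"
  shows "coarse_solution A P Q (A *v u) u\<^sub>c \<longleftrightarrow>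
    (\<forall>z. (E *v (P *v z)) \<bullet> (A *v (u - E *v (P *v u\<^sub>c))) = 0)"
proof -
  have "coarse_solution A P Q (A *v u) u\<^sub>c \<longleftrightarrow>
      transpose P *v (transpose E *v (A *v (u - E *v (P *v u\<^sub>c)))) = 0"
    unfolding coarse_solution_def E_def [symmetric]
    by (auto simp: matrix_vector_mul_assoc [symmetric] matrix_vector_mult_diff_distrib
        simp del: transpose_matrix_vector)
  also have "\<dots> \<longleftrightarrow> (\<forall>z. (transpose P *v (transpose E *v (A *v (u - E *v (P *v u\<^sub>c))))) \<bullet> z = 0)"
    by (metis inner_eq_zero_iff inner_zero_left)
  finally show ?thesis
    by (simp only: inner_transpose_mult) (simp only: inner_commute)
qed

theorem theorem3p5:
  fixes A D :: "real^'n^'n"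
    and P :: "real^'nc^'n"
    and P_perp :: "real^'nf^'n"
    and \<A> :: "'n set set"
    and c :: "'nc \<Rightarrow> 'n set"
    and d :: "'nf \<Rightarrow> 'n set"
    and \<eta>\<^sub>w :: real
    and f u e :: "real^'n"
  assumes "spd A"
    and "spd D" and "diagonal D"
    and "\<forall>v. v \<bullet> (A *v v) \<le> v \<bullet> (D *v v)"
    and "partition_on UNIV \<A>"
    and "CARD('nc) < CARD('n)" and "CARD('nf) = CARD('n) - CARD('nc)"
    and "rank P = CARD('nc)"
    and "block_diagonal \<A> c P"
    and "is_P_perp \<A> D c P d P_perp"
    and "\<eta>\<^sub>w > 0"
    and "weak_approximation A D P \<eta>\<^sub>w"
    and "A *v u = f"
    and "e = u - (mat 1 - pi_f A P_perp) *v (pi_D D P *v u)"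
  shows "(\<exists>!u\<^sub>c. coarse_solution A P P_perp f u\<^sub>c) \<and>
    (\<forall>u\<^sub>c. coarse_solution A P P_perp f u\<^sub>c \<longrightarrow>
       e = u - (mat 1 - pi_f A P_perp) *v (P *v u\<^sub>c)) \<and>
    norm_wrt D e \<le> \<eta>\<^sub>w * norm_wrt A e \<and>
    \<eta>\<^sub>w * norm_wrt A e \<le> \<eta>\<^sub>w\<^sup>2 * norm (diag_inv_sqrt D *v (A *v u))"
proof -
  let ?Q = P_perp
  define E where "E = mat 1 - pi_f A ?Q"
  have E: "E *v x = x - pi_f A ?Q *v x" for x
    by (simp add: E_def matrix_vector_mult_diff_rdistrib)
  have inj_P: "inj ((*v) P)"
    using assms(8) by (simp add: full_rank_injective)
  have inj_Q: "inj ((*v) ?Q)"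
    by (rule inj_P_perp [OF assms(3,5,10)])
  have orth: "(?Q *v y) \<bullet> (D *v (P *v z)) = 0" for y z
    by (rule range_P_perp_orthogonal [OF assms(3,5,9,10)])
  have E_orth: "(E *v x) \<bullet> (A *v (?Q *v y)) = 0" for x y
    using pi_D_residual_orthogonal [OF assms(1) inj_Q, of y x]
    by (simp add: E pi_f_eq_pi_D spd_inner_commute [OF assms(1), of _ "?Q *v y"])

  \<comment> \<open>The error is the \<open>A\<close>-orthogonal projection of \<open>u\<close> onto the range of \<open>P_perp\<close>.\<close>
  have "(u - pi_D D P *v u) \<bullet> (D *v (P *v z)) = 0" for z
    using pi_D_residual_orthogonal [OF assms(2) inj_P] spd_inner_commute [OF assms(2)] by metis
  then obtain y where y: "u - pi_D D P *v u = ?Q *v y"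
    using orthogonal_complement_in_range [OF assms(2) inj_P inj_Q orth] assms(6,7) by fastforce
  have "pi_f A ?Q *v (u - pi_D D P *v u) = u - pi_D D P *v u"
    unfolding y pi_f_eq_pi_D by (rule pi_D_fixes_range [OF assms(1) inj_Q])
  then have e: "e = pi_f A ?Q *v u"
    unfolding assms(14) E_def [symmetric] E matrix_vector_mult_diff_distrib
    by (simp add: diff_eq_eq)
  then obtain x where x: "e = ?Q *v x"
    using pi_D_in_range [of A ?Q u] by (auto simp: pi_f_eq_pi_D)

  have D_bound: "norm_wrt D e \<le> \<eta>\<^sub>w * norm_wrt A e"
    using weak_approximation_complement [OF assms(2,12)] orth by (simp add: x)
  have "e \<bullet> (A *v (u - e)) = 0"
    using E_orth [of u x] spd_inner_commute [OF assms(1)] by (metis E e x)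
  then have "(norm_wrt A e)\<^sup>2 = e \<bullet> (A *v u)"
    by (simp add: norm_wrt_squared [OF assms(1)] matrix_vector_mult_diff_distrib inner_diff_right)
  also have "\<dots> \<le> norm_wrt D e * norm (diag_inv_sqrt D *v (A *v u))"
    by (rule inner_le_norm_wrt_dual [OF assms(2,3)])
  also have "\<dots> \<le> \<eta>\<^sub>w * norm_wrt A e * norm (diag_inv_sqrt D *v (A *v u))"
    by (intro mult_right_mono D_bound) simp
  finally have "norm_wrt A e * norm_wrt A e
      \<le> norm_wrt A e * (\<eta>\<^sub>w * norm (diag_inv_sqrt D *v (A *v u)))"
    by (simp add: power2_eq_square ac_simps)
  then have "norm_wrt A e \<le> \<eta>\<^sub>w * norm (diag_inv_sqrt D *v (A *v u))"
    using norm_wrt_nonneg [OF assms(1), of e] assms(11)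
    by (cases "norm_wrt A e = 0") auto
  then have A_bound: "\<eta>\<^sub>w * norm_wrt A e \<le> \<eta>\<^sub>w\<^sup>2 * norm (diag_inv_sqrt D *v (A *v u))"
    using assms(11) by (simp add: power2_eq_square mult.assoc)

  note coarse = coarse_solution_iff_orthogonal [of A P ?Q u, unfolded assms(13), folded E_def]
  obtain u\<^sub>0 where u\<^sub>0: "pi_D D P *v u = P *v u\<^sub>0"
    using pi_D_in_range by blast
  have e_u\<^sub>0: "e = u - E *v (P *v u\<^sub>0)"
    by (simp add: assms(14) u\<^sub>0 E_def)
  have sol: "coarse_solution A P ?Q f u\<^sub>0"
    unfolding coarse e_u\<^sub>0 [symmetric] x using E_orth by blast
  have unique: "u\<^sub>1 = u\<^sub>0" if "coarse_solution A P ?Q f u\<^sub>1" for u\<^sub>1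
  proof -
    define w where "w = u\<^sub>1 - u\<^sub>0"
    have diff: "E *v (P *v w) = (u - E *v (P *v u\<^sub>0)) - (u - E *v (P *v u\<^sub>1))"
      by (simp add: w_def matrix_vector_mult_diff_distrib)
    \<comment> \<open>Both errors are \<open>A\<close>-orthogonal to \<open>E P w\<close>, which is itself their difference.\<close>
    have "(E *v (P *v w)) \<bullet> (A *v ((u - E *v (P *v u\<^sub>0)) - (u - E *v (P *v u\<^sub>1)))) = 0"
      using sol that unfolding coarse
      by (simp only: matrix_vector_mult_diff_distrib [of A] inner_diff_right)
    then have "E *v (P *v w) = 0"
      unfolding diff [symmetric] by (rule spd_inner_eq_0 [OF assms(1)])
    \<comment> \<open>So \<open>P w\<close> lies in both ranges, which are \<open>D\<close>-orthogonal.\<close>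
    then obtain z where "P *v w = ?Q *v z"
      using pi_D_in_range [of A ?Q "P *v w"] by (auto simp: E pi_f_eq_pi_D)
    then have "P *v w = 0"
      using orth spd_inner_eq_0 [OF assms(2)] by metis
    then have "w = 0"
      using inj_P by (metis injD matrix_vector_mult_0_right)
    then show ?thesis
      by (simp add: w_def)
  qed
  show ?thesis
    unfolding E_def [symmetric]
    using sol unique e_u\<^sub>0 D_bound A_bound by blast
qed

end
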